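(* Let $\mathcal X,\mathcal Y$ be complex separable Hilbert spaces, let $A\in\mathcal B(\mathcal X)$, $B\in\mathcal B(\mathcal Y,\mathcal X)$, and assume that the row operator $(A\ B)\in\mathcal B(\mathcal X\oplus\mathcal Y,\mathcal X)$ is right invertible. Let $\mathcal X_1,\mathcal X_2,\mathcal Y_2,A_2,B_2$ be as defined in the context. Then $B_2$ considered as an operator from $\mathcal Y_2$ to $\mathcal R(B_2)$ is one-to-one and has an inverse $B_2^{-1}:\mathcal R(B_2)\to\mathcal Y_2$. Define $$\widetilde A_2:=(0\ A_2):\mathcal X_1\oplus\mathcal X_2\to\overline{\mathcal R(A)}\cap\overline{\mathcal R(B)}.$$ Then $\widetilde A_2|_{P_{\mathcal X}(\mathcal N((A\ B)))}$ maps to $\mathcal R(B_2)$ and the operator $$B_2^{-1}\widetilde A_2|_{P_{\mathcal X}(\mathcal N((A\ B)))}:P_{\mathcal X}(\mathcal N((A\ B)))\to\mathcal Y_2$$ is correctly defined. If $\mathcal R(B)$ is closed, then $B_2:\mathcal Y_2\to\overline{\mathcal R(A)}\cap\overline{\mathcal R(B)}$ is an isomorphism, we have $$\mathcal X_1\oplus\mathcal X_2=\mathcal N(P_{\mathcal R(B)^\perp}A)=P_{\mathcal X}(\mathcal N((A\ B))),$$ and the operator $B_2^{-1}\widetilde A_2:\mathcal N(P_{\mathcal R(B)^\perp}A)\to\mathcal Y_2$ is correctly defined.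
   Context: $\mathcal B(\mathcal X,\mathcal Y)$ denotes the bounded linear operators from $\mathcal X$ to $\mathcal Y$, and $\mathcal B(\mathcal X)=\mathcal B(\mathcal X,\mathcal X)$. $\mathcal R(T)$ and $\mathcal N(T)$ denote range and kernel of $T$. An isomorphism is a linear bijection that is bounded with bounded inverse. $T\in\mathcal B(\mathcal X,\mathcal Y)$ is right invertible if there is $S\in\mathcal B(\mathcal Y,\mathcal X)$ with $TS=I_{\mathcal Y}$. $P_\Omega$ is the orthogonal projection onto a closed subspace $\Omega$; $P_{\mathcal X}$ is the projection of $\mathcal X\oplus\mathcal Y$ onto the first component. For closed subspaces $\Omega_1\subset\Omega$, $\Omega\ominus\Omega_1$ is the orthogonal complement of $\Omega_1$ in $\Omega$. The row operator is $(A\ B)\binom{x}{y}=Ax+By$. Define $\mathcal X_1:=\mathcal N(A)$, $\mathcal X_2:=\mathcal N(A)^\perp\ominus\mathcal N(P_{\mathcal R(B)^\perp}A)^\perp$, $\mathcal Y_2:=\mathcal N(B)^\perp\ominus\mathcal N(P_{\mathcal R(A)^\perp}B)^\perp$. Let $A_2:\mathcal X_2\to\overline{\mathcal R(A)}\cap\overline{\mathcal R(B)}$ and $B_2:\mathcal Y_2\to\overline{\mathcal R(A)}\cap\overline{\mathcal R(B)}$ be the restrictions of $A$ to $\mathcal X_2$ and of $B$ to $\mathcal Y_2$ (they do take values in $\overline{\mathcal R(A)}\cap\overline{\mathcal R(B)}$). "Correctly defined" for $B_2^{-1}\widetilde A_2$ on a subspace $S$ means that $S$ is contained in the domain $\mathcal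 X_1\oplus\mathcal X_2$ of $\widetilde A_2$ and that $\widetilde A_2$ maps $S$ into $\mathcal R(B_2)$, the domain of $B_2^{-1}$. *)

theory Defs
  imports "HOL-Analysis.Analysis"
begin

text \<open>
  A complex Hilbert space is a complete real inner product space (with its norm, metric and
  topology) that carries a complex scalar multiplication extending the real one and a sesquilinear
  form whose real part is the given real inner product. The form is linear in the first argument;
  positive definiteness is inherited from the real inner product.
\<close>

class complex_hilbert_space = real_inner + complete_space +
  fixes scaleC :: "complex \<Rightarrow> 'a \<Rightarrow> 'a" (infixr \<open>*\<^sub>C\<close> 75)
    and cinner :: "'a \<Rightarrow> 'a \<Rightarrow> complex"
  assumes scaleC_add_right: "a *\<^sub>C (x + y) = a *\<^sub>C x + a *\<^sub>C y"
    and scaleC_add_left: "(a + b) *\<^sub>C x = a *\<^sub>C x + b *\<^sub>C x"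
    and scaleC_scaleC: "a *\<^sub>C (b *\<^sub>C x) = (a * b) *\<^sub>C x"
    and scaleC_of_real: "complex_of_real r *\<^sub>C x = scaleR r x"
    and cinner_commute: "cinner x y = cnj (cinner y x)"
    and cinner_add_left: "cinner (x + y) z = cinner x z + cinner y z"
    and cinner_scaleC_left: "cinner (a *\<^sub>C x) y = a * cinner x y"
    and Re_cinner: "Re (cinner x y) = inner x y"

instantiation complex :: complex_hilbert_space
begin

definition scaleC_complex :: "complex \<Rightarrow> complex \<Rightarrow> complex" where
  "scaleC_complex a x = a * x"

definition cinner_complex :: "complex \<Rightarrow> complex \<Rightarrow> complex" where
  "cinner_complex x y = x * cnj y"

instance
  by standard
    (simp_all add: scaleC_complex_def cinner_complex_def algebra_simps scaleR_conv_of_real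
      inner_complex_def)

end

instantiation prod :: (complex_hilbert_space, complex_hilbert_space) complex_hilbert_space
begin

definition scaleC_prod :: "complex \<Rightarrow> 'a \<times> 'b \<Rightarrow> 'a \<times> 'b" where
  "scaleC_prod a p = (a *\<^sub>C fst p, a *\<^sub>C snd p)"

definition cinner_prod :: "'a \<times> 'b \<Rightarrow> 'a \<times> 'b \<Rightarrow> complex" where
  "cinner_prod p q = cinner (fst p) (fst q) + cinner (snd p) (snd q)"

instance
proof
  fix p q :: "'a \<times> 'b"
  show "cinner p q = cnj (cinner q p)"
    unfolding cinner_prod_def
    by (metis cinner_commute complex_cnj_add)
qed (simp_all add: scaleC_prod_def cinner_prod_def scaleC_add_right scaleC_add_left scaleC_scaleC
      scaleC_of_real cinner_add_left cinner_scaleC_left Re_cinner algebra_simps prod_eq_iff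
      inner_prod_def)

end

definition bounded_clinear :: "('a::complex_hilbert_space \<Rightarrow> 'b::complex_hilbert_space) \<Rightarrow> bool" where
  "bounded_clinear T \<longleftrightarrow> bounded_linear T \<and> (\<forall>c x. T (c *\<^sub>C x) = c *\<^sub>C T x)"

definition clinear_on ::
  "'a set \<Rightarrow> ('a::complex_hilbert_space \<Rightarrow> 'b::complex_hilbert_space) \<Rightarrow> bool" where
  "clinear_on S T \<longleftrightarrow>
     (\<forall>x\<in>S. \<forall>y\<in>S. T (x + y) = T x + T y) \<and> (\<forall>c. \<forall>x\<in>S. T (c *\<^sub>C x) = c *\<^sub>C T x)"

definition bounded_clinear_on ::
  "'a set \<Rightarrow> ('a::complex_hilbert_space \<Rightarrow> 'b::complex_hilbert_space) \<Rightarrow> bool" where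
  "bounded_clinear_on S T \<longleftrightarrow> clinear_on S T \<and> (\<exists>K. \<forall>x\<in>S. norm (T x) \<le> K * norm x)"

definition isomorphism_on ::
  "'a set \<Rightarrow> 'b set \<Rightarrow> ('a::complex_hilbert_space \<Rightarrow> 'b::complex_hilbert_space) \<Rightarrow> bool" where
  "isomorphism_on S S' T \<longleftrightarrow>
     bij_betw T S S' \<and> bounded_clinear_on S T \<and> bounded_clinear_on S' (inv_into S T)"

definition right_invertible ::
  "('a::complex_hilbert_space \<Rightarrow> 'b::complex_hilbert_space) \<Rightarrow> bool" where
  "right_invertible T \<longleftrightarrow> (\<exists>S. bounded_clinear S \<and> T \<circ> S = id)"

definition null_space :: "('a \<Rightarrow> 'b::zero) \<Rightarrow> 'a set" where
  "null_space T = {x. T x = 0}"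

definition ocompl :: "'a::complex_hilbert_space set \<Rightarrow> 'a set" where
  "ocompl M = {x. \<forall>y\<in>M. cinner x y = 0}"

definition ominus :: "'a::complex_hilbert_space set \<Rightarrow> 'a set \<Rightarrow> 'a set" where
  "ominus M N = M \<inter> ocompl N"

text \<open>Meaningful for closed subspaces \<open>M\<close>, where such a \<open>p\<close> exists and is unique.\<close>

definition oproj :: "'a::complex_hilbert_space set \<Rightarrow> 'a \<Rightarrow> 'a" where
  "oproj M x = (THE p. p \<in> M \<and> x - p \<in> ocompl M)"

text \<open>
  Internal sum of subspaces; it is used below only for mutually orthogonal subspaces of one space.
  The external sum of two spaces is the product type.
\<close>

definition internal_sum :: "'a::complex_hilbert_space set \<Rightarrow> 'a set \<Rightarrow> 'a set" where
  "internal_sum S T = {u + v | u v. u \<in> S \<and> v \<in> T}"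

definition row_op :: "('a \<Rightarrow> 'c::plus) \<Rightarrow> ('b \<Rightarrow> 'c) \<Rightarrow> 'a \<times> 'b \<Rightarrow> 'c" where
  "row_op A B p = A (fst p) + B (snd p)"

text \<open>
  The row operator \<open>(F G)\<close> on an internal direct sum of \<open>S\<close> and \<open>T\<close>: \<open>u + v\<close> is identified with
  the pair \<open>(u, v)\<close>, where \<open>u \<in> S\<close> and \<open>v \<in> T\<close>. Unspecified outside the sum.
\<close>

definition internal_row_op ::
  "'a::complex_hilbert_space set \<Rightarrow> 'a set \<Rightarrow>
   ('a \<Rightarrow> 'b::complex_hilbert_space) \<Rightarrow> ('a \<Rightarrow> 'b) \<Rightarrow> 'a \<Rightarrow> 'b" where
  "internal_row_op S T F G x = (THE z. \<exists>u\<in>S. \<exists>v\<in>T. x = u + v \<and> z = row_op F G (u, v))"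

text \<open>
  A composition of an operator \<open>F\<close> with domain \<open>D\<close> and an operator with domain \<open>E\<close> is correctly
  defined on \<open>S\<close>.
\<close>

definition correctly_defined :: "'a set \<Rightarrow> 'a set \<Rightarrow> ('a \<Rightarrow> 'b) \<Rightarrow> 'b set \<Rightarrow> bool" where
  "correctly_defined S D F E \<longleftrightarrow> S \<subseteq> D \<and> F ` S \<subseteq> E"

definition space_X1 :: "('a::complex_hilbert_space \<Rightarrow> 'a) \<Rightarrow> 'a set" where
  "space_X1 A = null_space A"

definition space_X2 ::
  "('a::complex_hilbert_space \<Rightarrow> 'a) \<Rightarrow> ('b::complex_hilbert_space \<Rightarrow> 'a) \<Rightarrow> 'a set" where
  "space_X2 A B =
     ominus (ocompl (null_space A)) (ocompl (null_space (oproj (ocompl (range B)) \<circ> A)))"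

definition space_Y2 ::
  "('a::complex_hilbert_space \<Rightarrow> 'a) \<Rightarrow> ('b::complex_hilbert_space \<Rightarrow> 'a) \<Rightarrow> 'b set" where
  "space_Y2 A B =
     ominus (ocompl (null_space B)) (ocompl (null_space (oproj (ocompl (range A)) \<circ> B)))"

definition op_A2 ::
  "('a::complex_hilbert_space \<Rightarrow> 'a) \<Rightarrow> ('b::complex_hilbert_space \<Rightarrow> 'a) \<Rightarrow> 'a \<Rightarrow> 'a" where
  "op_A2 A B = restrict A (space_X2 A B)"

definition op_B2 ::
  "('a::complex_hilbert_space \<Rightarrow> 'a) \<Rightarrow> ('b::complex_hilbert_space \<Rightarrow> 'a) \<Rightarrow> 'b \<Rightarrow> 'a" where
  "op_B2 A B = restrict B (space_Y2 A B)"

definition range_B2 ::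
  "('a::complex_hilbert_space \<Rightarrow> 'a) \<Rightarrow> ('b::complex_hilbert_space \<Rightarrow> 'a) \<Rightarrow> 'a set" where
  "range_B2 A B = op_B2 A B ` space_Y2 A B"

definition inv_B2 ::
  "('a::complex_hilbert_space \<Rightarrow> 'a) \<Rightarrow> ('b::complex_hilbert_space \<Rightarrow> 'a) \<Rightarrow> 'a \<Rightarrow> 'b" where
  "inv_B2 A B = restrict (inv_into (space_Y2 A B) (op_B2 A B)) (range_B2 A B)"

definition op_A2_tilde ::
  "('a::complex_hilbert_space \<Rightarrow> 'a) \<Rightarrow> ('b::complex_hilbert_space \<Rightarrow> 'a) \<Rightarrow> 'a \<Rightarrow> 'a" where
  "op_A2_tilde A B = internal_row_op (space_X1 A) (space_X2 A B) (\<lambda>_. 0) (op_A2 A B)"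

end

(* The spaces unfold to X2 = N(A)^perp \<inter> N and Y2 = N(B)^perp \<inter> B^-1(cl R(A)), where
   N = A^-1(cl R(B)) is the kernel of the projected operator. Hence X1 + X2 = N, the operator
   A2-tilde is just A on N, and R(B2) = R(B) \<inter> cl R(A). The first component of the kernel of the
   row operator is A^-1(R(B)), which lies in N and is mapped by A into R(B2). When R(B) is closed the
   two sets agree, and the open mapping theorem makes the inverse of B2 bounded. *)

theory Submission
  imports Defs
begin

text \<open>The projection theorem and the open mapping argument below are stated for real Banach
  spaces; this instance makes them apply to complex Hilbert spaces.\<close>

instance complex_hilbert_space < banach ..

section \<open>Orthogonal projection\<close>

text \<open>A minimising sequence for the distance from \<open>x\<close> to \<open>M\<close> is
  Cauchy by the parallelogram law, so it converges to a nearest point \<open>p\<close>. Minimality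
  along each line through \<open>p\<close> in \<open>M\<close> forces orthogonality.\<close>

lemma orthogonal_projection_exists:
  fixes M :: "'a::{real_inner,banach} set"
  assumes "subspace M" "closed M"
  shows "\<exists>p\<in>M. \<forall>y\<in>M. inner (x - p) y = 0"
proof -
  define d where "d = infdist x M"
  have M0: "M \<noteq> {}"
    using subspace_0[OF assms(1)] by blast
  have d0: "0 \<le> d"
    by (simp add: d_def infdist_nonneg)
  have dle: "d\<^sup>2 \<le> (norm (x - y))\<^sup>2" if "y \<in> M" for y
    using infdist_le[OF that, of x] d0 by (auto simp: d_def dist_norm intro: power_mono)
  \<comment> \<open>The slack is put on the squared distance, so that it enters the parallelogram
    identity linearly.\<close>
  have "\<exists>y\<in>M. (norm (x - y))\<^sup>2 < d\<^sup>2 + inverse (real (Suc n))" for n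
  proof -
    have "d < sqrt (d\<^sup>2 + inverse (real (Suc n)))"
      by (rule real_less_rsqrt) simp
    then obtain y where y: "y \<in> M" "dist x y < sqrt (d\<^sup>2 + inverse (real (Suc n)))"
      using M0 cINF_less_iff[of M "dist x"] by (auto simp: d_def infdist_def)
    then have "(norm (x - y))\<^sup>2 < (sqrt (d\<^sup>2 + inverse (real (Suc n))))\<^sup>2"
      by (intro power_strict_mono) (auto simp: dist_norm)
    then show ?thesis
      using y(1) by (auto simp: add_nonneg_nonneg)
  qed
  then obtain Y where Y: "\<And>n. Y n \<in> M"
    "\<And>n. (norm (x - Y n))\<^sup>2 < d\<^sup>2 + inverse (real (Suc n))"
    by metis
  \<comment> \<open>The midpoint of \<open>Y m\<close> and \<open>Y n\<close> lies in
    \<open>M\<close>, so its squared distance to \<open>x\<close> is at least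
    \<open>d\<^sup>2\<close>. In the parallelogram identity this cancels all multiples of
    \<open>d\<^sup>2\<close> and leaves only the slacks.\<close>
  have near: "(norm (Y m - Y n))\<^sup>2 < 2 * inverse (real (Suc m)) + 2 * inverse (real (Suc n))" for m n
  proof -
    have "(1/2) *\<^sub>R (Y m + Y n) \<in> M"
      using Y(1) assms(1) by (simp add: subspace_add subspace_scale)
    then have "d\<^sup>2 \<le> (norm (x - (1/2) *\<^sub>R (Y m + Y n)))\<^sup>2"
      by (rule dle)
    moreover have "(norm (Y m - Y n))\<^sup>2 = 2 * (norm (x - Y m))\<^sup>2 + 2 * (norm (x - Y n))\<^sup>2
        - 4 * (norm (x - (1/2) *\<^sub>R (Y m + Y n)))\<^sup>2"
      by (simp add: power2_norm_eq_inner inner_diff inner_add inner_commute algebra_simps)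
    ultimately show ?thesis
      using Y(2)[of m] Y(2)[of n] by linarith
  qed
  have "Cauchy Y"
  proof (rule metric_CauchyI)
    fix e :: real assume "0 < e"
    then obtain N where N: "inverse (real (Suc N)) < e\<^sup>2 / 4"
      using reals_Archimedean[of "e\<^sup>2 / 4"] by auto
    have "dist (Y m) (Y n) < e" if "N \<le> m" "N \<le> n" for m n
    proof -
      have le: "inverse (real (Suc k)) \<le> inverse (real (Suc N))" if "N \<le> k" for k
        using that by (simp add: divide_simps)
      then have "(norm (Y m - Y n))\<^sup>2 < e\<^sup>2"
        using near[of m n] N le[OF that(1)] le[OF that(2)] by linarith
      then show ?thesis
        using \<open>0 < e\<close> by (simp add: dist_norm power_less_imp_less_base)
    qed
    then show "\<exists>N. \<forall>m\<ge>N. \<forall>n\<ge>N. dist (Y m) (Y n) < e"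
      by blast
  qed
  then obtain p where p: "Y \<longlonglongrightarrow> p"
    using Cauchy_convergent convergent_def by blast
  then have pM: "p \<in> M"
    using assms(2) Y(1) closed_sequentially by blast
  have "(norm (x - p))\<^sup>2 \<le> d\<^sup>2 + 0"
  proof (rule LIMSEQ_le)
    show "(\<lambda>n. (norm (x - Y n))\<^sup>2) \<longlonglongrightarrow> (norm (x - p))\<^sup>2"
      using p by (intro tendsto_intros)
    show "(\<lambda>n. d\<^sup>2 + inverse (real (Suc n))) \<longlonglongrightarrow> d\<^sup>2 + 0"
      by (intro tendsto_intros LIMSEQ_inverse_real_of_nat)
  qed (use Y(2) less_imp_le in blast)
  then have pmin: "(norm (x - p))\<^sup>2 \<le> (norm (x - y))\<^sup>2" if "y \<in> M" for y
    using dle[OF that] by linarith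
  have "inner (x - p) y = 0" if y: "y \<in> M" for y
  proof (cases "y = 0")
    case False
    \<comment> \<open>This \<open>t\<close> minimises the quadratic
      \<open>(norm (x - p - t *\<^sub>R y))\<^sup>2\<close>, which makes the inequality from
      \<open>pmin\<close> sharpest.\<close>
    define t where "t = inner (x - p) y / inner y y"
    have yy: "inner y y > 0"
      using False by simp
    have "p + t *\<^sub>R y \<in> M"
      using pM y assms(1) by (simp add: subspace_add subspace_scale)
    from pmin[OF this] have "0 \<le> t * (t * inner y y) - 2 * (t * inner (x - p) y)"
      by (simp add: power2_norm_eq_inner inner_diff inner_add inner_commute algebra_simps)
    then have "(inner (x - p) y)\<^sup>2 / inner y y \<le> 0"
      using yy by (simp add: t_def power2_eq_square)
    then show ?thesis
      using yy by (simp add: divide_le_0_iff)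
  qed simp
  then show ?thesis
    using pM by blast
qed

section \<open>Complex subspaces\<close>

lemma cinner_zero_left [simp]: "cinner 0 (x::'a::complex_hilbert_space) = 0"
  using cinner_add_left[of 0 0 x] by simp

lemma cinner_scaleC_right: "cinner x (c *\<^sub>C (y::'a::complex_hilbert_space)) = cnj c * cinner x y"
  by (metis cinner_commute cinner_scaleC_left complex_cnj_mult)

lemma cinner_self_eq_0: "cinner x x = 0 \<Longrightarrow> (x::'a::complex_hilbert_space) = 0"
  by (metis Re_cinner inner_eq_zero_iff zero_complex.sel(1))

lemma cinner_eq_0_commute: "cinner x y = 0 \<longleftrightarrow> cinner y (x::'a::complex_hilbert_space) = 0"
  by (metis cinner_commute complex_cnj_zero)

lemma norm_scaleC: "norm (c *\<^sub>C (x::'a::complex_hilbert_space)) = cmod c * norm x"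
proof -
  have "cinner (c *\<^sub>C x) (c *\<^sub>C x) = complex_of_real ((cmod c)\<^sup>2) * cinner x x"
    by (simp only: cinner_scaleC_left cinner_scaleC_right complex_norm_square mult.assoc mult.left_commute)
  then have "(norm (c *\<^sub>C x))\<^sup>2 = (cmod c * norm x)\<^sup>2"
    unfolding power2_norm_eq_inner power_mult_distrib Re_cinner[symmetric] by simp
  then show ?thesis
    by simp
qed

definition csubspace :: "'a::complex_hilbert_space set \<Rightarrow> bool" where
  "csubspace M \<longleftrightarrow> 0 \<in> M \<and> (\<forall>x\<in>M. \<forall>y\<in>M. x + y \<in> M) \<and> (\<forall>c. \<forall>x\<in>M. c *\<^sub>C x \<in> M)"

lemma
  assumes "csubspace M"
  shows csubspace_0: "0 \<in> M"
    and csubspace_add: "\<lbrakk>x \<in> M; y \<in> M\<rbrakk> \<Longrightarrow> x + y \<in> M"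
    and csubspace_scaleC: "x \<in> M \<Longrightarrow> c *\<^sub>C x \<in> M"
    and csubspace_imp_subspace: "subspace M"
proof -
  show "subspace M"
    using assms unfolding csubspace_def subspace_def by (metis scaleC_of_real)
qed (use assms in \<open>auto simp: csubspace_def\<close>)

lemma csubspace_diff: "\<lbrakk>csubspace M; x \<in> M; y \<in> M\<rbrakk> \<Longrightarrow> x - y \<in> M"
  using csubspace_imp_subspace subspace_diff by blast

lemma csubspace_Int: "\<lbrakk>csubspace M; csubspace N\<rbrakk> \<Longrightarrow> csubspace (M \<inter> N)"
  by (simp add: csubspace_def)

text \<open>Gives continuity of multiplication by a complex scalar, through which closures inherit
  complex scaling.\<close>

lemma bounded_linear_scaleC: "bounded_linear (\<lambda>x::'a::complex_hilbert_space. c *\<^sub>C x)"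
proof (rule bounded_linear_intro)
  show "c *\<^sub>C (r *\<^sub>R x) = r *\<^sub>R (c *\<^sub>C x)" for r and x :: 'a
    by (metis scaleC_of_real scaleC_scaleC mult.commute)
  show "norm (c *\<^sub>C x) \<le> norm x * cmod c" for x :: 'a
    by (simp add: norm_scaleC)
qed (rule scaleC_add_right)

lemma csubspace_closure:
  assumes "csubspace M"
  shows "csubspace (closure M)"
proof -
  have "c *\<^sub>C x \<in> closure M" if "x \<in> closure M" for c x
  proof -
    have "(\<lambda>x. c *\<^sub>C x) ` closure M \<subseteq> closure M"
      using assms closure_subset[of M]
      by (intro image_closure_subset linear_continuous_on bounded_linear_scaleC)
         (auto simp: csubspace_def)
    then show ?thesis
      using that by blast
  qed
  moreover have "x + y \<in> closure M" if xy: "x \<in> closure M" "y \<in> closure M" for x y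
  proof -
    obtain f g where "\<forall>n. f n \<in> M" "f \<longlonglongrightarrow> x" "\<forall>n. g n \<in> M" "g \<longlonglongrightarrow> y"
      using xy unfolding closure_sequential by blast
    then show ?thesis
      unfolding closure_sequential using csubspace_add[OF assms]
      by (intro exI[of _ "\<lambda>n. f n + g n"]) (auto intro: tendsto_add)
  qed
  moreover have "0 \<in> closure M"
    using assms closure_subset csubspace_0 by blast
  ultimately show ?thesis
    by (simp add: csubspace_def)
qed

section \<open>Orthogonal complements\<close>

lemma csubspace_ocompl: "csubspace (ocompl M)"
  by (simp add: csubspace_def ocompl_def cinner_add_left cinner_scaleC_left)

lemma ocompl_antimono: "M \<subseteq> N \<Longrightarrow> ocompl N \<subseteq> ocompl M"
  by (auto simp: ocompl_def)

lemma subset_ocompl_ocompl: "M \<subseteq> ocompl (ocompl M)"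
  using cinner_eq_0_commute by (fastforce simp: ocompl_def)

lemma ocompl_Int_self: "\<lbrakk>x \<in> M; x \<in> ocompl M\<rbrakk> \<Longrightarrow> x = 0"
  by (auto simp: ocompl_def intro: cinner_self_eq_0)

text \<open>The form is conjugate linear in the second argument, so replacing \<open>y\<close> by
  \<open>\<i> *\<^sub>C y\<close> multiplies it by -i and moves its imaginary part into the real
  part. Complex orthogonality thus becomes two real orthogonality conditions.\<close>

lemma cinner_conv_inner:
  "cinner x (y::'a::complex_hilbert_space) = Complex (inner x y) (inner x (\<i> *\<^sub>C y))"
  by (simp add: complex_eq_iff cinner_scaleC_right flip: Re_cinner)

lemma closed_ocompl: "closed (ocompl M)"
proof -
  have "ocompl M = (\<Inter>y\<in>M. {x. inner x y = 0} \<inter> {x. inner x (\<i> *\<^sub>C y) = 0})"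
    by (auto simp: ocompl_def cinner_conv_inner complex_eq_iff)
  then show ?thesis
    by (auto intro!: closed_INT closed_Int closed_Collect_eq continuous_intros)
qed

text \<open>The real projection already works: \<open>M\<close> contains
  \<open>\<i> *\<^sub>C y\<close> along with \<open>y\<close>, so real orthogonality to all of
  \<open>M\<close> gives complex orthogonality.\<close>

lemma ocompl_decompose:
  assumes "csubspace M" "closed M"
  obtains p where "p \<in> M" "x - p \<in> ocompl M"
proof -
  obtain p where p: "p \<in> M" "\<And>y. y \<in> M \<Longrightarrow> inner (x - p) y = 0"
    using orthogonal_projection_exists[OF csubspace_imp_subspace[OF assms(1)] assms(2)] by metis
  then have "x - p \<in> ocompl M"
    using csubspace_scaleC[OF assms(1)] by (simp add: ocompl_def cinner_conv_inner complex_eq_iff)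
  with p(1) show ?thesis
    by (rule that)
qed

text \<open>Two candidates for the projection differ by an element of both \<open>M\<close> and
  \<open>ocompl M\<close>, so the description in \<open>oproj\<close> is unique. For
  \<open>x\<close> in \<open>ocompl M\<close> the candidate 0 qualifies. The later proofs use
  \<open>oproj\<close> only through its kernel.\<close>

lemma oproj_eq_0_iff:
  assumes "csubspace M" "closed M"
  shows "oproj M x = 0 \<longleftrightarrow> x \<in> ocompl M"
proof -
  obtain p where p: "p \<in> M" "x - p \<in> ocompl M"
    using ocompl_decompose[OF assms] .
  have unique: "q = p" if "q \<in> M" "x - q \<in> ocompl M" for q
  proof -
    have "q - p \<in> M"
      using that p assms(1) by (simp add: csubspace_diff)
    moreover have "q - p \<in> ocompl M"
      using csubspace_diff[OF csubspace_ocompl p(2) that(2)] by simp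
    ultimately show ?thesis
      using ocompl_Int_self by fastforce
  qed
  then have "oproj M x = p"
    unfolding oproj_def using p by blast
  then show ?thesis
    using p unique[of 0] csubspace_0[OF assms(1)] by auto
qed

text \<open>Project \<open>x\<close> onto \<open>closure M\<close>: the remainder
  \<open>x - p\<close> lies in \<open>ocompl M\<close> and also in its complement, so it vanishes.
  The closure appears because the lemma is applied to ranges that may fail to be closed.\<close>

lemma ocompl_ocompl:
  assumes "csubspace M"
  shows "ocompl (ocompl M) = closure M"
proof
  show "closure M \<subseteq> ocompl (ocompl M)"
    by (rule closure_minimal[OF subset_ocompl_ocompl closed_ocompl])
  show "ocompl (ocompl M) \<subseteq> closure M"
  proof
    fix x assume x: "x \<in> ocompl (ocompl M)"
    obtain p where p: "p \<in> closure M" "x - p \<in> ocompl (closure M)"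
      using ocompl_decompose[OF csubspace_closure[OF assms] closed_closure] .
    have "x - p \<in> ocompl M"
      using p(2) ocompl_antimono[OF closure_subset] by blast
    moreover have "x - p \<in> ocompl (ocompl M)"
      using x p(1) closure_minimal[OF subset_ocompl_ocompl closed_ocompl]
      by (intro csubspace_diff[OF csubspace_ocompl]) blast+
    ultimately have "x = p"
      using ocompl_Int_self by fastforce
    then show "x \<in> closure M"
      using p(1) by simp
  qed
qed

section \<open>Orthogonal internal sums and row operators on them\<close>

lemma internal_sum_ominus:
  assumes "csubspace M" "closed M" "csubspace N" "M \<subseteq> N"
  shows "internal_sum M (ocompl M \<inter> N) = N"
proof
  show "internal_sum M (ocompl M \<inter> N) \<subseteq> N"
    using assms(3,4) by (auto simp: internal_sum_def csubspace_add subset_iff)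
  show "N \<subseteq> internal_sum M (ocompl M \<inter> N)"
  proof
    fix x assume x: "x \<in> N"
    obtain p where p: "p \<in> M" "x - p \<in> ocompl M"
      using ocompl_decompose[OF assms(1,2)] .
    then have "x - p \<in> N"
      using x assms(3,4) by (simp add: csubspace_diff subset_iff)
    then show "x \<in> internal_sum M (ocompl M \<inter> N)"
      unfolding internal_sum_def using p by force
  qed
qed

text \<open>Resolves the definite description: two decompositions of the same vector differ by an
  element of \<open>S\<close> that is also in \<open>T\<close>, hence orthogonal to itself.\<close>

lemma internal_row_op_add:
  assumes "csubspace S" "csubspace T" "T \<subseteq> ocompl S" "u \<in> S" "v \<in> T"
  shows "internal_row_op S T F G (u + v) = F u + G v"
proof -
  have "u' = u \<and> v' = v" if "u' \<in> S" "v' \<in> T" "u + v = u' + v'" for u' v'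
  proof -
    have eq: "u' - u = v - v'"
      using that(3) by (simp add: algebra_simps)
    have "u' - u \<in> S"
      using that(1) assms by (simp add: csubspace_diff)
    moreover have "v - v' \<in> T"
      using that(2) assms by (simp add: csubspace_diff)
    ultimately have "u' - u = 0"
      using eq assms(3) ocompl_Int_self[of "u' - u" S] by auto
    with eq show ?thesis
      by simp
  qed
  then show ?thesis
    unfolding internal_row_op_def row_op_def using assms(4,5) by (auto intro!: the_equality)
qed

section \<open>Bounded operators\<close>

lemma
  assumes "bounded_clinear T"
  shows bounded_clinear_imp_bounded_linear: "bounded_linear T"
    and bounded_clinear_scaleC: "T (c *\<^sub>C x) = c *\<^sub>C T x"
    and bounded_clinear_zero: "T 0 = 0"
    and bounded_clinear_add: "T (x + y) = T x + T y"
    and bounded_clinear_diff: "T (x - y) = T x - T y"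
    and bounded_clinear_minus: "T (- x) = - T x"
  using assms by (auto simp: bounded_clinear_def linear_0 linear_add linear_diff linear_neg
      bounded_linear.linear)

lemma csubspace_vimage:
  assumes "bounded_clinear T" "csubspace M"
  shows "csubspace (T -` M)"
  using assms by (simp add: csubspace_def bounded_clinear_add bounded_clinear_scaleC
      bounded_clinear_zero)

lemma csubspace_image:
  assumes "bounded_clinear T" "csubspace M"
  shows "csubspace (T ` M)"
  unfolding csubspace_def
proof (intro conjI ballI allI)
  show "0 \<in> T ` M"
    using assms by (metis bounded_clinear_zero csubspace_0 imageI)
next
  fix x y assume "x \<in> T ` M" "y \<in> T ` M"
  then show "x + y \<in> T ` M"
    using assms by (auto simp: csubspace_add simp flip: bounded_clinear_add)
next
  fix c x assume "x \<in> T ` M"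
  then show "c *\<^sub>C x \<in> T ` M"
    using assms by (auto simp: csubspace_scaleC simp flip: bounded_clinear_scaleC)
qed

lemma csubspace_range: "bounded_clinear T \<Longrightarrow> csubspace (range T)"
  by (rule csubspace_image) (simp_all add: csubspace_def)

lemma closed_vimage_bounded_clinear:
  assumes "bounded_clinear T" "closed M"
  shows "closed (T -` M)"
  using assms by (intro continuous_closed_vimage linear_continuous_at
      bounded_clinear_imp_bounded_linear)

lemma null_space_eq_vimage: "null_space T = T -` {0}"
  by (auto simp: null_space_def)

lemma csubspace_null_space: "bounded_clinear T \<Longrightarrow> csubspace (null_space T)"
  unfolding null_space_eq_vimage by (rule csubspace_vimage)
    (simp_all add: csubspace_def linear_0[OF bounded_linear.linear[OF bounded_linear_scaleC]])

lemma closed_null_space: "bounded_clinear T \<Longrightarrow> closed (null_space T)"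
  unfolding null_space_eq_vimage by (rule closed_vimage_bounded_clinear) simp_all

text \<open>The projection onto the complement of \<open>range B\<close> kills exactly the double
  complement of \<open>range B\<close>, which is its closure. This removes the projections from all
  later arguments.\<close>

lemma null_space_oproj_comp:
  assumes "bounded_clinear B"
  shows "null_space (oproj (ocompl (range B)) \<circ> A) = A -` closure (range B)"
  using assms by (auto simp: null_space_def oproj_eq_0_iff csubspace_ocompl closed_ocompl
      ocompl_ocompl csubspace_range)

text \<open>Subtracting from \<open>y\<close> its kernel component leaves the image unchanged, and
  by Pythagoras does not increase the norm. The norm bound is what later makes inverses
  bounded.\<close>

lemma image_ocompl_null_space:
  assumes "bounded_clinear T"
  obtains z where "z \<in> ocompl (null_space T)" "T z = T y" "norm z \<le> norm y"
proof -
  obtain p where p: "p \<in> null_space T" "y - p \<in> ocompl (null_space T)"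
    using ocompl_decompose[OF csubspace_null_space[OF assms] closed_null_space[OF assms]] .
  have "T (y - p) = T y"
    using p(1) assms by (simp add: bounded_clinear_diff null_space_def)
  moreover have "norm (y - p) \<le> norm y"
  proof -
    have "inner (y - p) p = 0"
      using p by (simp add: ocompl_def flip: Re_cinner)
    then have "(norm y)\<^sup>2 = (norm (y - p))\<^sup>2 + (norm p)\<^sup>2"
      by (simp add: power2_norm_eq_inner inner_diff inner_commute)
    then show ?thesis
      by (simp add: power2_le_imp_le)
  qed
  ultimately show ?thesis
    using p(2) that by blast
qed

lemma inj_on_ocompl_null_space:
  assumes "bounded_clinear T"
  shows "inj_on T (ocompl (null_space T))"
proof (rule inj_onI)
  fix x y assume "x \<in> ocompl (null_space T)" "y \<in> ocompl (null_space T)" "T x = T y"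
  then have "x - y \<in> ocompl (null_space T)" "x - y \<in> null_space T"
    using assms by (simp_all add: csubspace_diff csubspace_ocompl null_space_def bounded_clinear_diff)
  then show "x = y"
    using ocompl_Int_self by fastforce
qed

text \<open>The open mapping theorem for an operator with closed range, by Baire category in the range
  and successive approximation.\<close>

lemma closed_range_bounded_preimage:
  fixes T :: "'a::banach \<Rightarrow> 'b::banach"
  assumes "bounded_linear T" "closed (range T)"
  shows "\<exists>K. \<forall>w\<in>range T. \<exists>v. T v = w \<and> norm v \<le> K * norm w"
proof -
  interpret T: bounded_linear T by fact
  let ?W = "range T"
  have W: "subspace ?W"
    using T.linear_axioms by (simp add: linear_subspace_image)
  define F where "F n = closure (T ` cball 0 (real n))" for n :: nat
  have FW: "F n \<subseteq> ?W" for n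
    unfolding F_def by (rule closure_minimal) (use assms(2) in auto)
  have closed_F: "closed (F n)" for n
    by (simp add: F_def)
  \<comment> \<open>The closed sets \<open>F n\<close> cover \<open>?W\<close>, which is completely
    metrizable because it is closed. If all had empty relative interior, Baire would give
    \<open>?W\<close> empty interior in itself, although it is nonempty.\<close>
  have "\<exists>n. top_of_set ?W interior_of F n \<noteq> {}"
  proof (rule ccontr)
    assume none: "\<nexists>n. top_of_set ?W interior_of F n \<noteq> {}"
    then have "top_of_set ?W interior_of \<Union>(range F) = {}"
    proof (intro Baire_category_alt)
      show "completely_metrizable_space (top_of_set ?W) \<or>
          locally_compact_space (top_of_set ?W) \<and> regular_space (top_of_set ?W)"
        using assms(2)
        by (simp add: completely_metrizable_space_closedin completely_metrizable_space_euclidean)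
      show "closedin (top_of_set ?W) S \<and> top_of_set ?W interior_of S = {}" if "S \<in> range F" for S
        using that FW closed_F none by (auto intro: closed_subset)
    qed simp
    moreover have "\<Union>(range F) = ?W"
    proof -
      have "T v \<in> F (nat \<lceil>norm v\<rceil>)" for v
        unfolding F_def by (rule closure_subset[THEN subsetD]) (auto simp: of_nat_ceiling)
      then show ?thesis
        using FW by blast
    qed
    ultimately show False
      by (simp add: interior_of_topspace[of "top_of_set ?W", simplified])
  qed
  then obtain n w0 where "w0 \<in> top_of_set ?W interior_of F n"
    by blast
  then obtain U where U: "open U" "w0 \<in> U" "w0 \<in> ?W" "?W \<inter> U \<subseteq> F n"
    by (auto simp: interior_of_def openin_open)
  then obtain r where r: "0 < r" "cball w0 r \<subseteq> U"
    using open_contains_cball by metis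
  \<comment> \<open>The ball around \<open>w0\<close> is moved to the origin: \<open>w0 + w\<close>
    and \<open>w0\<close> are both limits of images of the ball of radius \<open>n\<close>, and
    subtracting the approximate preimages costs a factor 2 in the norm.\<close>
  have step0: "\<exists>v. norm v \<le> 2 * real n \<and> norm (w - T v) \<le> e"
    if w: "w \<in> ?W" "norm w \<le> r" and e: "0 < e" for w e
  proof -
    have approx: "\<exists>v. norm v \<le> real n \<and> dist (T v) z < e / 2" if "z \<in> F n" for z
      using that half_gt_zero[OF e] unfolding F_def closure_approachable by fastforce
    have "w0 + w \<in> cball w0 r"
      using w(2) by (simp add: dist_norm)
    then have "w0 + w \<in> F n" "w0 \<in> F n"
      using U r(2) subspace_add[OF W U(3) w(1)] by blast+
    then obtain v1 v0 where v: "norm v1 \<le> real n" "dist (T v1) (w0 + w) < e / 2"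
      "norm v0 \<le> real n" "dist (T v0) w0 < e / 2"
      using approx by meson
    have "norm (w - T (v1 - v0)) = norm ((T v0 - w0) - (T v1 - (w0 + w)))"
      by (simp add: T.diff algebra_simps)
    also have "\<dots> \<le> e / 2 + e / 2"
      using v by (intro norm_triangle_le_diff) (auto simp: dist_norm)
    finally have "norm (w - T (v1 - v0)) \<le> e"
      by simp
    moreover have "norm (v1 - v0) \<le> 2 * real n"
      using v norm_triangle_ineq4[of v1 v0] by linarith
    ultimately show ?thesis
      by blast
  qed
  define K where "K = 2 * real n / r"
  have step: "\<exists>v. norm v \<le> K * norm w \<and> norm (w - T v) \<le> norm w / 2" if w: "w \<in> ?W" for w
  proof (cases "w = 0")
    case True
    then show ?thesis
      by (intro exI[of _ 0]) simp
  next
    case False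
    \<comment> \<open>Scales \<open>w\<close> to norm \<open>r\<close>, where \<open>step0\<close>
      applies with error \<open>r / 2\<close>; dividing by \<open>s\<close> turns that error into
      \<open>norm w / 2\<close> and the bound \<open>2 * real n\<close> into
      \<open>K * norm w\<close>.\<close>
    define s where "s = r / norm w"
    have s: "0 < s"
      using r(1) False by (simp add: s_def)
    obtain v where v: "norm v \<le> 2 * real n" "norm (s *\<^sub>R w - T v) \<le> r / 2"
      using step0[of "s *\<^sub>R w" "r / 2"] subspace_scale[OF W w] r(1) False by (auto simp: s_def)
    have "norm (w - T ((1 / s) *\<^sub>R v)) = norm ((1 / s) *\<^sub>R (s *\<^sub>R w - T v))"
      using s by (simp add: T.scaleR scaleR_diff_right)
    also have "\<dots> = norm (s *\<^sub>R w - T v) / s"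
      using s by simp
    also have "\<dots> \<le> (r / 2) / s"
      using v(2) s by (intro divide_right_mono) auto
    also have "\<dots> = norm w / 2"
      using r(1) False by (simp add: s_def)
    finally have "norm (w - T ((1 / s) *\<^sub>R v)) \<le> norm w / 2" .
    moreover have "norm ((1 / s) *\<^sub>R v) \<le> K * norm w"
    proof -
      have "norm ((1 / s) *\<^sub>R v) = norm v / s"
        using s by simp
      also have "\<dots> \<le> 2 * real n / s"
        using v(1) s by (intro divide_right_mono) auto
      finally show ?thesis
        by (simp add: K_def s_def)
    qed
    ultimately show ?thesis
      by blast
  qed
  then obtain g where g: "\<And>w. w \<in> ?W \<Longrightarrow> norm (g w) \<le> K * norm w"
    "\<And>w. w \<in> ?W \<Longrightarrow> norm (w - T (g w)) \<le> norm w / 2"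
    by metis
  have K0: "0 \<le> K"
    using r(1) by (simp add: K_def)
  \<comment> \<open>Correct the residual repeatedly. Each correction halves it, so the corrections
    are dominated by a geometric series of ratio 1/2, whose sum gives the factor 2.\<close>
  have "\<exists>v. T v = w \<and> norm v \<le> (2 * K) * norm w" if w: "w \<in> ?W" for w
  proof -
    define R where "R k = ((\<lambda>u. u - T (g u)) ^^ k) w" for k
    have R0: "R 0 = w" and RSuc: "R (Suc k) = R k - T (g (R k))" for k
      by (simp_all add: R_def)
    have RW: "R k \<in> ?W" for k
      by (induction k) (auto simp: R0 RSuc w intro!: subspace_diff[OF W])
    have Rn: "norm (R k) \<le> norm w * (1/2) ^ k" for k
    proof (induction k)
      case (Suc k)
      then show ?case
        using g(2)[OF RW, of k] by (simp add: RSuc)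
    qed (simp add: R0)
    have gn: "norm (g (R k)) \<le> K * norm w * (1/2) ^ k" for k
      using g(1)[OF RW, of k] mult_left_mono[OF Rn K0, of k] by (simp add: mult.assoc)
    have geo: "summable (\<lambda>k. K * norm w * (1/2) ^ k)"
      by (intro summable_mult summable_geometric) simp
    have sn: "summable (\<lambda>k. norm (g (R k)))"
      by (rule summable_comparison_test'[OF geo, of 0]) (simp add: gn)
    then have sg: "summable (\<lambda>k. g (R k))"
      by (rule summable_norm_cancel)
    have "norm (\<Sum>k. g (R k)) \<le> (\<Sum>k. norm (g (R k)))"
      by (rule summable_norm[OF sn])
    also have "\<dots> \<le> (\<Sum>k. K * norm w * (1/2) ^ k)"
      by (rule suminf_le[OF gn sn geo])
    also have "\<dots> = 2 * K * norm w"
      by (simp add: suminf_mult suminf_geometric)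
    finally have "norm (\<Sum>k. g (R k)) \<le> 2 * K * norm w" .
    moreover have "T (\<Sum>k. g (R k)) = w"
    proof -
      have "R \<longlonglongrightarrow> 0"
      proof (rule Lim_null_comparison)
        show "\<forall>\<^sub>F k in sequentially. norm (R k) \<le> norm w * (1/2) ^ k"
          using Rn by simp
        show "(\<lambda>k. norm w * (1/2) ^ k) \<longlonglongrightarrow> 0"
          by (intro tendsto_mult_right_zero LIMSEQ_power_zero) simp
      qed
      \<comment> \<open>The images of the corrections are the successive differences of the
        residuals, so their sum telescopes.\<close>
      then have "(\<lambda>k. R k - R (Suc k)) sums (R 0 - 0)"
        by (rule telescope_sums')
      then have "(\<lambda>k. T (g (R k))) sums w"
        by (simp add: RSuc R0)
      then show ?thesis
        using T.suminf[OF sg] sums_unique by metis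
    qed
    ultimately show ?thesis
      by blast
  qed
  then show ?thesis
    by (intro exI[of _ "2 * K"] ballI)
qed

text \<open>A preimage with controlled norm may lie outside \<open>V\<close>. Its part orthogonal to
  the kernel has no larger norm and the same image, so by injectivity it is the given
  \<open>v\<close>; this bounds the inverse.\<close>

lemma closed_range_isomorphism_on:
  assumes B: "bounded_clinear B" and cl: "closed (range B)"
    and V: "V \<subseteq> ocompl (null_space B)" "csubspace V"
  shows "isomorphism_on V (B ` V) B"
proof -
  have inj: "inj_on B V"
    by (rule inj_on_subset[OF inj_on_ocompl_null_space[OF B] V(1)])
  obtain K where K: "\<forall>w\<in>range B. \<exists>v. B v = w \<and> norm v \<le> K * norm w"
    using closed_range_bounded_preimage[OF bounded_clinear_imp_bounded_linear[OF B] cl] by blast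
  have "norm v \<le> K * norm (B v)" if "v \<in> V" for v
  proof -
    obtain y where y: "B y = B v" "norm y \<le> K * norm (B v)"
      using K by blast
    obtain z where z: "z \<in> ocompl (null_space B)" "B z = B y" "norm z \<le> norm y"
      using image_ocompl_null_space[OF B] .
    have "v = z"
      using y(1) z(1,2) that V(1) by (intro inj_onD[OF inj_on_ocompl_null_space[OF B]]) auto
    then show ?thesis
      using y z by simp
  qed
  then have "bounded_clinear_on (B ` V) (inv_into V B)"
    unfolding bounded_clinear_on_def clinear_on_def using V(2) inj
    by (auto simp: csubspace_add csubspace_scaleC
        simp flip: bounded_clinear_add[OF B] bounded_clinear_scaleC[OF B])
  moreover have "bounded_clinear_on V B"
    using bounded_linear.bounded[OF bounded_clinear_imp_bounded_linear[OF B]] B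
    by (auto simp: bounded_clinear_on_def clinear_on_def bounded_clinear_add
        bounded_clinear_scaleC mult.commute)
  ultimately show ?thesis
    using inj by (simp add: isomorphism_on_def inj_on_imp_bij_betw)
qed

text \<open>\<open>inv_into\<close> consults only values on \<open>V\<close>. Closure of
  \<open>V\<close> under addition and scaling keeps the linearity conditions away from the points
  where \<open>restrict\<close> is \<open>undefined\<close>.\<close>

lemma isomorphism_on_restrict:
  assumes "csubspace V" "isomorphism_on V W T"
  shows "isomorphism_on V W (restrict T V)"
proof -
  have "inv_into V (restrict T V) = inv_into V T"
    unfolding inv_into_def by (intro ext arg_cong[where f = Eps]) auto
  then show ?thesis
    using assms unfolding isomorphism_on_def bounded_clinear_on_def clinear_on_def
    by (simp add: csubspace_add csubspace_scaleC cong: bij_betw_cong)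
qed

section \<open>The spaces of the decomposition\<close>

text \<open>The set subtracted by \<open>ominus\<close> is the complement of a preimage that is
  already a closed subspace, so the double complement collapses to that preimage.\<close>

lemma
  assumes "bounded_clinear A" "bounded_clinear B"
  shows space_X2_eq: "space_X2 A B = ocompl (null_space A) \<inter> A -` closure (range B)"
    and space_Y2_eq: "space_Y2 A B = ocompl (null_space B) \<inter> B -` closure (range A)"
  using assms
  by (simp_all add: space_X2_def space_Y2_def ominus_def null_space_oproj_comp ocompl_ocompl
      csubspace_vimage csubspace_closure csubspace_range closed_vimage_bounded_clinear)

theorem lemma2p9:
  fixes A :: "'x::complex_hilbert_space \<Rightarrow> 'x"
    and B :: "'y::complex_hilbert_space \<Rightarrow> 'x"
  assumes "separable_space (euclidean :: 'x topology)"
    and "separable_space (euclidean :: 'y topology)"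
    and "bounded_clinear A"
    and "bounded_clinear B"
    and "right_invertible (row_op A B)"
  shows "op_A2 A B \<in> space_X2 A B \<rightarrow> closure (range A) \<inter> closure (range B) \<and>
    op_B2 A B \<in> space_Y2 A B \<rightarrow> closure (range A) \<inter> closure (range B) \<and>
    op_A2_tilde A B \<in> internal_sum (space_X1 A) (space_X2 A B)
      \<rightarrow> closure (range A) \<inter> closure (range B) \<and>
    inj_on (op_B2 A B) (space_Y2 A B) \<and>
    inv_B2 A B \<in> range_B2 A B \<rightarrow> space_Y2 A B \<and>
    clinear_on (range_B2 A B) (inv_B2 A B) \<and>
    (\<forall>y\<in>space_Y2 A B. inv_B2 A B (op_B2 A B y) = y) \<and>
    (\<forall>z\<in>range_B2 A B. op_B2 A B (inv_B2 A B z) = z) \<and>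
    op_A2_tilde A B \<in> fst ` null_space (row_op A B) \<rightarrow> range_B2 A B \<and>
    correctly_defined (fst ` null_space (row_op A B))
      (internal_sum (space_X1 A) (space_X2 A B)) (op_A2_tilde A B) (range_B2 A B) \<and>
    inv_B2 A B \<circ> op_A2_tilde A B \<in> fst ` null_space (row_op A B) \<rightarrow> space_Y2 A B \<and>
    (closed (range B) \<longrightarrow>
       isomorphism_on (space_Y2 A B) (closure (range A) \<inter> closure (range B)) (op_B2 A B) \<and>
       internal_sum (space_X1 A) (space_X2 A B) = null_space (oproj (ocompl (range B)) \<circ> A) \<and>
       null_space (oproj (ocompl (range B)) \<circ> A) = fst ` null_space (row_op A B) \<and>
       correctly_defined (null_space (oproj (ocompl (range B)) \<circ> A))
         (internal_sum (space_X1 A) (space_X2 A B)) (op_A2_tilde A B) (range_B2 A B) \<and>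
       inv_B2 A B \<circ> op_A2_tilde A B
         \<in> null_space (oproj (ocompl (range B)) \<circ> A) \<rightarrow> space_Y2 A B)"
proof -
  let ?C = "closure (range A) \<inter> closure (range B)"
  let ?X1 = "space_X1 A" and ?X2 = "space_X2 A B" and ?Y2 = "space_Y2 A B"
  let ?N = "A -` closure (range B)" and ?P = "fst ` null_space (row_op A B)"
  note A = \<open>bounded_clinear A\<close> and B = \<open>bounded_clinear B\<close>
  note X2 = space_X2_eq[OF A B] and Y2 = space_Y2_eq[OF A B]
  have sX1: "csubspace ?X1" and sX2: "csubspace ?X2" and sY2: "csubspace ?Y2"
    unfolding X2 Y2 space_X1_def using A B
    by (auto intro!: csubspace_Int csubspace_ocompl csubspace_vimage csubspace_closure
        csubspace_range csubspace_null_space)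
  have X1N: "?X1 \<subseteq> ?N"
    using csubspace_0[OF csubspace_closure[OF csubspace_range[OF B]]]
    by (auto simp: space_X1_def null_space_def)
  \<comment> \<open>By \<open>X2\<close>, the second summand is the orthogonal complement of
    \<open>?X1\<close> inside \<open>?N\<close>.\<close>
  have sum: "internal_sum ?X1 ?X2 = ?N"
    unfolding X2 space_X1_def using A B X1N
    by (intro internal_sum_ominus csubspace_null_space closed_null_space csubspace_vimage
        csubspace_closure csubspace_range) (simp_all add: space_X1_def)
  \<comment> \<open>The row operator discards the component in \<open>?X1\<close>, which
    \<open>A\<close> annihilates anyway.\<close>
  have tilde: "op_A2_tilde A B x = A x" if "x \<in> ?N" for x
  proof -
    have "x \<in> internal_sum ?X1 ?X2"
      using that sum by simp
    then obtain u v where uv: "u \<in> ?X1" "v \<in> ?X2" "x = u + v"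
      unfolding internal_sum_def by blast
    have "?X2 \<subseteq> ocompl ?X1"
      unfolding X2 space_X1_def by blast
    then have "op_A2_tilde A B x = A v"
      unfolding op_A2_tilde_def uv(3) using uv
      by (subst internal_row_op_add[OF sX1 sX2]) (auto simp: op_A2_def)
    then show ?thesis
      using uv A by (simp add: space_X1_def null_space_def bounded_clinear_add)
  qed
  have P: "?P = {x. A x \<in> range B}"
  proof (intro subset_antisym subsetI)
    fix x assume "x \<in> ?P"
    then obtain y where "A x + B y = 0"
      by (auto simp: null_space_def row_op_def)
    then have "A x = B (- y)"
      using B by (simp add: bounded_clinear_minus eq_neg_iff_add_eq_0)
    then show "x \<in> {x. A x \<in> range B}"
      by blast
  next
    fix x assume "x \<in> {x. A x \<in> range B}"
    then obtain y where "A x = B y"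
      by blast
    then have "(x, - y) \<in> null_space (row_op A B)"
      using B by (simp add: null_space_def row_op_def bounded_clinear_minus)
    then show "x \<in> ?P"
      by force
  qed
  then have PN: "?P \<subseteq> ?N"
    using closure_subset by blast
  \<comment> \<open>A preimage under \<open>B\<close> can be replaced by its part orthogonal to the
    kernel. The image is the same, so membership in \<open>closure (range A)\<close> survives and
    the new preimage lies in \<open>?Y2\<close>.\<close>
  have rB2: "range_B2 A B = range B \<inter> closure (range A)"
  proof (intro subset_antisym subsetI)
    fix w assume "w \<in> range B \<inter> closure (range A)"
    then obtain y where y: "w = B y" "B y \<in> closure (range A)"
      by blast
    obtain z where "z \<in> ocompl (null_space B)" "B z = B y"
      using image_ocompl_null_space[OF B] .
    with y show "w \<in> range_B2 A B"
      unfolding range_B2_def op_B2_def Y2 by (intro image_eqI[of _ _ z]) auto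
  qed (auto simp: range_B2_def op_B2_def Y2)
  have imB: "B ` ?Y2 = range_B2 A B"
    by (simp add: range_B2_def op_B2_def)
  have "inj_on B ?Y2"
    unfolding Y2 by (rule inj_on_subset[OF inj_on_ocompl_null_space[OF B] Int_lower1])
  then have inj: "inj_on (op_B2 A B) ?Y2"
    by (simp add: op_B2_def inj_on_def)
  have inv: "inv_B2 A B (op_B2 A B y) = y" if "y \<in> ?Y2" for y
    using that inj by (simp add: inv_B2_def range_B2_def)
  have inv': "inv_B2 A B (B y) = y" if "y \<in> ?Y2" for y
    using inv[OF that] that by (simp add: op_B2_def)
  have clin: "clinear_on (range_B2 A B) (inv_B2 A B)"
    unfolding clinear_on_def imB[symmetric]
    by (auto simp: inv' csubspace_add[OF sY2] csubspace_scaleC[OF sY2]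
        simp flip: bounded_clinear_add[OF B] bounded_clinear_scaleC[OF B])
  have invY2: "inv_B2 A B \<in> range_B2 A B \<rightarrow> ?Y2"
    unfolding range_B2_def using inv by auto
  have tildeP: "op_A2_tilde A B \<in> ?P \<rightarrow> range_B2 A B"
  proof
    fix x assume x: "x \<in> ?P"
    then have "op_A2_tilde A B x = A x"
      using PN tilde by blast
    then show "op_A2_tilde A B x \<in> range_B2 A B"
      using x P closure_subset[of "range A"] by (auto simp: rB2)
  qed
  have cd: "correctly_defined ?P (internal_sum ?X1 ?X2) (op_A2_tilde A B) (range_B2 A B)"
    unfolding correctly_defined_def sum using PN tildeP by blast
  have comp: "inv_B2 A B \<circ> op_A2_tilde A B \<in> ?P \<rightarrow> ?Y2"
    using tildeP invY2 by (simp add: Pi_iff)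
  \<comment> \<open>The two sets are the preimages under \<open>A\<close> of
    \<open>closure (range B)\<close> and of \<open>range B\<close>, which now coincide.\<close>
  have NP: "?N = ?P" if "closed (range B)"
    using P that by (auto simp: closure_closed)
  have iso: "isomorphism_on ?Y2 ?C (op_B2 A B)" if "closed (range B)"
  proof -
    have "isomorphism_on ?Y2 (B ` ?Y2) B"
      by (rule closed_range_isomorphism_on[OF B that _ sY2]) (auto simp: Y2)
    \<comment> \<open>Closedness enters a second time here: by \<open>rB2\<close> the image is
      \<open>range B\<close> intersected with \<open>closure (range A)\<close>, which now fills the
      whole codomain.\<close>
    moreover have "B ` ?Y2 = ?C"
      using that by (auto simp: imB rB2 closure_closed)
    ultimately show ?thesis
      unfolding op_B2_def using isomorphism_on_restrict[OF sY2] by simp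
  qed
  have closed_case: "isomorphism_on ?Y2 ?C (op_B2 A B) \<and>
      internal_sum ?X1 ?X2 = null_space (oproj (ocompl (range B)) \<circ> A) \<and>
      null_space (oproj (ocompl (range B)) \<circ> A) = ?P \<and>
      correctly_defined (null_space (oproj (ocompl (range B)) \<circ> A))
        (internal_sum ?X1 ?X2) (op_A2_tilde A B) (range_B2 A B) \<and>
      inv_B2 A B \<circ> op_A2_tilde A B \<in> null_space (oproj (ocompl (range B)) \<circ> A) \<rightarrow> ?Y2"
    if "closed (range B)"
    using iso[OF that] NP[OF that] sum cd comp by (simp add: null_space_oproj_comp[OF B])
  have A2: "op_A2 A B \<in> ?X2 \<rightarrow> ?C" and B2: "op_B2 A B \<in> ?Y2 \<rightarrow> ?C"
    and tildeN: "op_A2_tilde A B \<in> internal_sum ?X1 ?X2 \<rightarrow> ?C"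
    using closure_subset[of "range A"] closure_subset[of "range B"] tilde
    unfolding sum by (auto simp: op_A2_def op_B2_def X2 Y2)
  have inv2: "op_B2 A B (inv_B2 A B z) = z" if "z \<in> range_B2 A B" for z
    using that inv by (auto simp: range_B2_def)
  show ?thesis
    using A2 B2 tildeN inj invY2 clin inv inv2 tildeP cd comp closed_case by blast
qed

end
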